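(* For every integer $t>2$, $$\delta_{t,3}(G_\infty) \leq \delta_{t-1,1}(G_\infty).$$
   Context: $G_\infty$ denotes the infinite grid: the graph with vertex set $\mathbb{Z}\times\mathbb{Z}$ in which two vertices are adjacent if and only if they are at Euclidean distance $1$. $dist(\cdot,\cdot)$ is the graph distance (so $dist((a,b),(c,d))=|a-c|+|b-d|$). Let $t,r$ be positive integers. For a set of vertices $\mathbb{T}\subseteq \mathbb{Z}\times\mathbb{Z}$ (whose elements are called towers, of signal strength $t$), the signal a vertex $v$ receives from a tower $T\in\mathbb{T}$ is $sig(v,T)=\min(\max(t-dist(v,T),0),r)$, and the total signal at $v$ is $sig(v)=\sum_{T\in\mathbb{T}} sig(v,T)$. The set $\mathbb{T}$ is a $(t,r)$ broadcast on $G_\infty$ if $sig(v)\geq r$ for every vertex $v$. (Omitting the truncation at $r$ in the definition of signal gives the same notion of broadcast.) The broadcast density of $\mathbb{T}$ is $\lim_{n\to\infty} \frac{|\mathbb{T}\cap V_n|}{|V_n|}$, where $V_n=\{-n,\dots,n\}\times\{-n,\dots,n\}$. The optimal density $\delta_{t,r}(G_\infty)$ is the minimum broadcast density over all $(t,r)$ broadcasts on $G_\infty$ (among those for which the limit exists). *)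

theory Defs
  imports "HOL-Analysis.Analysis"
begin

type_synonym vertex = "int \<times> int"

definition grid_point :: "vertex \<Rightarrow> real \<times> real" where
  "grid_point v = (real_of_int (fst v), real_of_int (snd v))"

text \<open>The metric of the library type \<^typ>\<open>real \<times> real\<close> is the Euclidean one.\<close>

definition grid_adj :: "vertex \<Rightarrow> vertex \<Rightarrow> bool" where
  "grid_adj u v \<longleftrightarrow> dist (grid_point u) (grid_point v) = 1"

definition grid_dist :: "vertex \<Rightarrow> vertex \<Rightarrow> nat" where
  "grid_dist u v = (LEAST n. (grid_adj ^^ n) u v)"

definition signal :: "int \<Rightarrow> int \<Rightarrow> vertex \<Rightarrow> vertex \<Rightarrow> int" where
  "signal t r v w = min (max (t - int (grid_dist v w)) 0) r"

text \<open>For \<open>r \<ge> 0\<close> and any tower set, finite or infinite, only finitely many towers contribute a nonzero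
  signal to a given vertex, so the infinite sum always converges; see
  \<open>total_signal_eq_sum\<close> below.\<close>

definition total_signal :: "int \<Rightarrow> int \<Rightarrow> vertex set \<Rightarrow> vertex \<Rightarrow> int" where
  "total_signal t r T v = (\<Sum>\<^sub>\<infinity>w\<in>T. signal t r v w)"

definition broadcast :: "int \<Rightarrow> int \<Rightarrow> vertex set \<Rightarrow> bool" where
  "broadcast t r T \<longleftrightarrow> (\<forall>v. total_signal t r T v \<ge> r)"

definition grid_box :: "nat \<Rightarrow> vertex set" where
  "grid_box n = {- int n..int n} \<times> {- int n..int n}"

definition has_density :: "vertex set \<Rightarrow> real \<Rightarrow> bool" where
  "has_density T d \<longleftrightarrow> (\<lambda>n. real (card (T \<inter> grid_box n)) / real (card (grid_box n))) \<longlonglongrightarrow> d"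

definition broadcast_densities :: "int \<Rightarrow> int \<Rightarrow> real set" where
  "broadcast_densities t r = {d. \<exists>T. broadcast t r T \<and> has_density T d}"

text \<open>The infimum is the minimum whenever the latter exists (\<open>optimal_density_eq_minimum\<close>),
  and for \<open>0 < r \<le> t\<close> it is taken over a nonempty set that is bounded below
  (\<open>broadcast_densities_nonempty\<close>, \<open>bdd_below_broadcast_densities\<close>).\<close>

definition optimal_density :: "int \<Rightarrow> int \<Rightarrow> real" where
  "optimal_density t r = Inf (broadcast_densities t r)"

lemma grid_adj_iff:
  "grid_adj (a, b) (c, d) \<longleftrightarrow> \<bar>a - c\<bar> + \<bar>b - d\<bar> = 1"
proof -
  have "grid_adj (a, b) (c, d) \<longleftrightarrow> (real_of_int a - real_of_int c)\<^sup>2 + (real_of_int b - real_of_int d)\<^sup>2 = 1"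
    by (simp add: grid_adj_def grid_point_def dist_prod_def dist_real_def)
  also have "\<dots> \<longleftrightarrow> real_of_int ((a - c)\<^sup>2 + (b - d)\<^sup>2) = real_of_int 1"
    by simp
  also have "\<dots> \<longleftrightarrow> (a - c)\<^sup>2 + (b - d)\<^sup>2 = 1"
    by (rule of_int_eq_iff)
  also have "\<dots> \<longleftrightarrow> \<bar>a - c\<bar> + \<bar>b - d\<bar> = 1"
  proof -
    have key: "x\<^sup>2 + y\<^sup>2 = 1 \<longleftrightarrow> \<bar>x\<bar> + \<bar>y\<bar> = 1" for x y :: int
    proof
      assume h: "x\<^sup>2 + y\<^sup>2 = 1"
      have "\<bar>x\<bar> \<le> x\<^sup>2" "\<bar>y\<bar> \<le> y\<^sup>2"
        using self_le_power[of "\<bar>x\<bar>" 2] self_le_power[of "\<bar>y\<bar>" 2]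
        by (cases "x = 0"; cases "y = 0"; simp)+
      with h have "\<bar>x\<bar> + \<bar>y\<bar> \<le> 1" by linarith
      moreover from h have "x \<noteq> 0 \<or> y \<noteq> 0" by auto
      ultimately show "\<bar>x\<bar> + \<bar>y\<bar> = 1" by linarith
    next
      assume "\<bar>x\<bar> + \<bar>y\<bar> = 1"
      then have "x = 0 \<and> \<bar>y\<bar> = 1 \<or> y = 0 \<and> \<bar>x\<bar> = 1" by linarith
      then show "x\<^sup>2 + y\<^sup>2 = 1" by (metis add_0 add.right_neutral power2_abs power_one zero_power2)
    qed
    show ?thesis by (rule key)
  qed
  finally show ?thesis .
qed

lemma grid_walk_length:
  "(grid_adj ^^ n) u v \<Longrightarrow> \<bar>fst u - fst v\<bar> + \<bar>snd u - snd v\<bar> \<le> int n"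
proof (induction n arbitrary: v)
  case 0
  then show ?case by simp
next
  case (Suc n)
  then obtain w where "(grid_adj ^^ n) u w" "grid_adj w v" by auto
  with Suc.IH[of w] grid_adj_iff[of "fst w" "snd w" "fst v" "snd v"] show ?case
    by simp
qed

lemma grid_walk_exists:
  "\<bar>fst u - fst v\<bar> + \<bar>snd u - snd v\<bar> = int n \<Longrightarrow> (grid_adj ^^ n) u v"
proof (induction n arbitrary: v)
  case 0
  then have "fst u = fst v" "snd u = snd v" by linarith+
  then show ?case by (simp add: prod_eq_iff)
next
  case (Suc n)
  obtain a b c d where uv: "u = (a, b)" "v = (c, d)" by fastforce
  have "\<exists>w. \<bar>fst u - fst w\<bar> + \<bar>snd u - snd w\<bar> = int n \<and> grid_adj w v"
  proof -
    consider "c < a" | "c > a" | "c = a" "d < b" | "c = a" "d > b"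
      using Suc.prems uv by fastforce
    then show ?thesis
    proof cases
      case 1
      show ?thesis by (rule exI[of _ "(c + 1, d)"]) (use 1 uv Suc.prems in \<open>simp add: grid_adj_iff\<close>)
    next
      case 2
      show ?thesis by (rule exI[of _ "(c - 1, d)"]) (use 2 uv Suc.prems in \<open>simp add: grid_adj_iff\<close>)
    next
      case 3
      show ?thesis by (rule exI[of _ "(c, d + 1)"]) (use 3 uv Suc.prems in \<open>simp add: grid_adj_iff\<close>)
    next
      case 4
      show ?thesis by (rule exI[of _ "(c, d - 1)"]) (use 4 uv Suc.prems in \<open>simp add: grid_adj_iff\<close>)
    qed
  qed
  then obtain w where "(grid_adj ^^ n) u w" "grid_adj w v" using Suc.IH by blast
  then show ?case by (rule relpowp_Suc_I)
qed

lemma grid_dist_eq: "int (grid_dist (a, b) (c, d)) = \<bar>a - c\<bar> + \<bar>b - d\<bar>"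
proof -
  have "grid_dist (a, b) (c, d) = nat (\<bar>a - c\<bar> + \<bar>b - d\<bar>)"
    unfolding grid_dist_def
    by (rule Least_equality) (auto intro: grid_walk_exists dest: grid_walk_length)
  then show ?thesis by simp
qed

lemma finite_grid_ball: "finite {w. int (grid_dist v w) < t}"
proof (rule finite_subset)
  show "{w. int (grid_dist v w) < t} \<subseteq> {fst v - t..fst v + t} \<times> {snd v - t..snd v + t}"
    using grid_dist_eq[of "fst v" "snd v"] by auto
  show "finite ({fst v - t..fst v + t} \<times> {snd v - t..snd v + t})" by simp
qed

lemma total_signal_eq_sum:
  assumes "r \<ge> 0"
  shows "total_signal t r T v = (\<Sum>w | w \<in> T \<and> int (grid_dist v w) < t. signal t r v w)"
proof -
  have "total_signal t r T v = (\<Sum>\<^sub>\<infinity>w\<in>{w. w \<in> T \<and> int (grid_dist v w) < t}. signal t r v w)"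
    unfolding total_signal_def by (rule infsum_cong_neutral) (use assms in \<open>auto simp: signal_def\<close>)
  also have "\<dots> = (\<Sum>w | w \<in> T \<and> int (grid_dist v w) < t. signal t r v w)"
    by (rule infsum_finite) (rule finite_subset[OF _ finite_grid_ball[of v t]], auto)
  finally show ?thesis .
qed

lemma bdd_below_broadcast_densities: "bdd_below (broadcast_densities t r)"
  by (rule bdd_belowI[of _ 0])
     (auto simp: broadcast_densities_def has_density_def intro: LIMSEQ_le_const)

lemma broadcast_densities_nonempty:
  assumes "0 < r" "r \<le> t"
  shows "broadcast_densities t r \<noteq> {}"
proof -
  have "r \<le> total_signal t r UNIV v" for v
  proof -
    have d: "int (grid_dist v v) = 0"
      using grid_dist_eq[of "fst v" "snd v" "fst v" "snd v"] by simp
    have "signal t r v v \<le> (\<Sum>w | w \<in> UNIV \<and> int (grid_dist v w) < t. signal t r v w)"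
      by (rule member_le_sum) (use assms d finite_grid_ball[of v t] in \<open>auto simp: signal_def\<close>)
    with assms d show ?thesis by (simp add: total_signal_eq_sum signal_def)
  qed
  then have "broadcast t r UNIV" by (simp add: broadcast_def)
  moreover have "has_density UNIV 1" by (simp add: has_density_def grid_box_def)
  ultimately show ?thesis by (auto simp: broadcast_densities_def)
qed

lemma optimal_density_eq_minimum:
  assumes "d \<in> broadcast_densities t r" "\<And>e. e \<in> broadcast_densities t r \<Longrightarrow> d \<le> e"
  shows "optimal_density t r = d"
  unfolding optimal_density_def using assms by (rule cInf_eq_minimum)

end

theory Submission
  imports Defs
begin

text \<open>
  Every \<open>(t - 1, 1)\<close> broadcast is already a \<open>(t, 3)\<close> broadcast, so the infimum of the densities
  can only decrease. Indeed, let \<open>k = t - 2 \<ge> 1\<close>. A \<open>(t - 1, 1)\<close> broadcast is a set of towers such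
  that each vertex lies within distance \<open>k\<close> of some tower. With strength \<open>t\<close>, a vertex \<open>v\<close> at
  distance less than \<open>k\<close> from a tower receives the full signal \<open>3\<close> from it. If \<open>v\<close> is at distance
  exactly \<open>k\<close> from a tower \<open>w\<close>, it receives \<open>2\<close> from \<open>w\<close>. A step from \<open>v\<close> directly away from \<open>w\<close>
  leads to a neighbour \<open>u\<close> at distance \<open>k + 1\<close> from \<open>w\<close>; the tower within distance \<open>k\<close> of \<open>u\<close> is
  therefore different from \<open>w\<close>, and being within distance \<open>k + 1\<close> of \<open>v\<close> it supplies the
  missing \<open>1\<close>.
\<close>

lemma sum_signal_le_total_signal:
  assumes "r \<ge> 0" "finite S" "S \<subseteq> T"
  shows "(\<Sum>w\<in>S. signal t r v w) \<le> total_signal t r T v"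
proof -
  let ?B = "{w. w \<in> T \<and> int (grid_dist v w) < t}"
  have fin: "finite ?B"
    by (rule finite_subset[OF _ finite_grid_ball[of v t]]) auto
  have "(\<Sum>w\<in>S. signal t r v w) = (\<Sum>w\<in>S \<inter> ?B. signal t r v w)"
    by (rule sum.mono_neutral_right) (use assms in \<open>auto simp: signal_def\<close>)
  also have "\<dots> \<le> (\<Sum>w\<in>?B. signal t r v w)"
    by (rule sum_mono2) (use assms fin in \<open>auto simp: signal_def\<close>)
  finally show ?thesis
    using assms(1) by (simp add: total_signal_eq_sum)
qed

lemma broadcast_tower_in_range:
  assumes "broadcast t r T" "r > 0"
  obtains w where "w \<in> T" "int (grid_dist v w) < t"
proof -
  have "r \<le> total_signal t r T v"
    using assms(1) unfolding broadcast_def by blast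
  then have "(\<Sum>w | w \<in> T \<and> int (grid_dist v w) < t. signal t r v w) \<noteq> 0"
    using assms(2) total_signal_eq_sum[of r t T v] by linarith
  then have "{w. w \<in> T \<and> int (grid_dist v w) < t} \<noteq> {}"
    by (metis sum.empty)
  with that show thesis by blast
qed

lemma grid_dist_step_away:
  obtains u where
    "int (grid_dist u w) = int (grid_dist v w) + 1"
    "\<And>x. int (grid_dist v x) \<le> int (grid_dist u x) + 1"
proof -
  define u where "u = (if fst v \<ge> fst w then fst v + 1 else fst v - 1, snd v)"
  have dist: "int (grid_dist x y) = \<bar>fst x - fst y\<bar> + \<bar>snd x - snd y\<bar>" for x y
    using grid_dist_eq[of "fst x" "snd x" "fst y" "snd y"] by simp
  show thesis
  proof (rule that)
    show "int (grid_dist u w) = int (grid_dist v w) + 1"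
      by (simp add: u_def dist)
    have "\<bar>fst v - fst u\<bar> = 1" "snd u = snd v"
      by (simp_all add: u_def)
    then show "int (grid_dist v x) \<le> int (grid_dist u x) + 1" for x
      unfolding dist by linarith
  qed
qed

lemma broadcast_1_imp_broadcast_3:
  assumes t: "t > 2" and T: "broadcast (t - 1) 1 T"
  shows "broadcast t 3 T"
  unfolding broadcast_def
proof
  fix v
  obtain w where w: "w \<in> T" "int (grid_dist v w) < t - 1"
    by (rule broadcast_tower_in_range[OF T]) simp
  show "3 \<le> total_signal t 3 T v"
  proof (cases "int (grid_dist v w) < t - 2")
    case True
    then have "3 = (\<Sum>x\<in>{w}. signal t 3 v x)" by (simp add: signal_def)
    also have "\<dots> \<le> total_signal t 3 T v"
      by (rule sum_signal_le_total_signal) (use w in auto)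
    finally show ?thesis .
  next
    case False
    with w have dw: "int (grid_dist v w) = t - 2" by simp
    obtain u where u: "int (grid_dist u w) = int (grid_dist v w) + 1"
      "\<And>x. int (grid_dist v x) \<le> int (grid_dist u x) + 1"
      by (rule grid_dist_step_away[of w v]) blast
    obtain w' where w': "w' \<in> T" "int (grid_dist u w') < t - 1"
      by (rule broadcast_tower_in_range[OF T]) simp
    have "w' \<noteq> w" using w' u(1) dw by auto
    have "int (grid_dist v w') < t" using u(2)[of w'] w' by linarith
    then have "3 \<le> signal t 3 v w + signal t 3 v w'"
      using dw by (simp add: signal_def)
    also have "\<dots> = (\<Sum>x\<in>{w, w'}. signal t 3 v x)" using \<open>w' \<noteq> w\<close> by simp
    also have "\<dots> \<le> total_signal t 3 T v"
      by (rule sum_signal_le_total_signal) (use w w' in auto)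
    finally show ?thesis .
  qed
qed

theorem theorem3:
  fixes t :: int
  assumes "t > 2"
  shows "optimal_density t 3 \<le> optimal_density (t - 1) 1"
  unfolding optimal_density_def
proof (rule cInf_superset_mono)
  show "broadcast_densities (t - 1) 1 \<noteq> {}"
    by (rule broadcast_densities_nonempty) (use assms in auto)
  show "bdd_below (broadcast_densities t 3)"
    by (rule bdd_below_broadcast_densities)
  show "broadcast_densities (t - 1) 1 \<subseteq> broadcast_densities t 3"
    using broadcast_1_imp_broadcast_3[OF assms] by (auto simp: broadcast_densities_def)
qed

end
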